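(* Let $K$ be a field of characteristic zero (e.g. $K=\mathbb{C}$ or $K=\mathbb{C}_p$), let $t$ be an indeterminate and $D=\frac{d}{dt}$ (acting on $K[t]$). Let $m\ge 2$ and let $T,Q_1,\dots,Q_m\in K[t]$ with $S'=\deg T$ and $r'_j=\deg Q_j$ ($j=1,\dots,m$), where $\deg$ of the zero polynomial is $-\infty$. Assume either $$S'\ge 0,\qquad r'_m=S'+1,\qquad r'_j<r'_m\ \text{ for all } j=1,\dots,m-1,$$ or $$r'_m\ge 0,\qquad S'=r'_m+1,\qquad r'_j\le r'_m\ \text{ for all } j=1,\dots,m.$$ Let $B_{0,1},\dots,B_{0,m}\in K[t]$ with $(B_{0,1},\dots,B_{0,m})\neq(0,\dots,0)$, and define polynomials $B_{n,j}\in K[t]$ for $n\ge 0$ recursively by $$B_{k+1,j}=Q_jB_{k,1}+T\,DB_{k,j}+T B_{k,j+1}\quad (j=1,\dots,m-1),\qquad B_{k+1,m}=Q_mB_{k,1}+T\,DB_{k,m},$$ for all $k\in\mathbb{N}$. Then for every $k\in\mathbb{N}$ the $m\times m$ determinant $$\det\mathcal{B}_k=\det\big(B_{k+i-1,j}\big)_{1\le i,j\le m}$$ is a nonzero polynomial.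
   Context: The polynomials $B_{n,j}$ are the coefficients of the linear forms $R_n=(TD)^nR=B_{n,1}D^{m-1}F+\dots+B_{n,m}D^0F$, where $R=B_{0,1}D^{m-1}F+\dots+B_{0,m}D^0F$ and $F$ is a nonzero function satisfying $TD^mF=Q_1D^{m-1}F+\dots+Q_mD^0F$; the recurrences above are obtained by applying $TD$ and using this differential equation to eliminate $D^mF$. $\mathbb{N}$ includes $0$. *)

theory Defs
  imports Jordan_Normal_Form.Determinant "HOL-Library.Extended_Real"
begin

text \<open>The library's \<^const>\<open>degree\<close> sends the zero polynomial to 0; here its degree is
  \<open>-\<infinity>\<close>.\<close>

definition edegree :: "'a::zero poly \<Rightarrow> ereal" where
  "edegree p = (if p = 0 then -\<infinity> else ereal (real (degree p)))"

text \<open>Matrices are indexed from 0 in the library, so entry \<open>(i, j)\<close> below is the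
  usual entry \<open>(i + 1, j + 1)\<close>, namely \<open>B (k + (i + 1) - 1) (j + 1)\<close>.\<close>

definition B_mat :: "nat \<Rightarrow> (nat \<Rightarrow> nat \<Rightarrow> 'a poly) \<Rightarrow> nat \<Rightarrow> 'a::zero poly mat" where
  "B_mat m B k = mat m m (\<lambda>(i, j). B (k + i) (j + 1))"

end

theory Submission
  imports Defs
begin

text \<open>Idea: give \<open>t\<close> the weight \<open>m\<close> and \<open>D\<close> the weight \<open>e\<close>, with \<open>e = 1\<close> under the first
  hypothesis on the degrees and \<open>e = -1\<close> under the second. All \<open>D\<^sup>iF\<close> with \<open>i < m\<close> then have
  weights that are distinct modulo \<open>m\<close>, so every nonzero linear form has a unique component of
  maximal weight. In both cases the hypotheses say that \<open>Q\<^sub>m F\<close> has the same weight as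
  \<open>T D\<^sup>mF\<close> and every other \<open>Q\<^sub>j D\<^bsup>m-j\<^esup>F\<close> a smaller one, so \<open>TD\<close> adds the constant
  \<open>m deg T + e\<close> to the weight and moves the position of the maximal component cyclically. Hence the
  maximal positions of \<open>m\<close> consecutive forms are a permutation, whose term in the Leibniz formula
  has larger degree than all others.\<close>

section \<open>Weighted degree bounds for polynomials\<close>

text \<open>The guard \<open>p \<noteq> 0\<close> plays the part of degree minus infinity: zero
  meets every bound, negative ones included. The factor \<open>m\<close> is the weight of t.\<close>

definition wdeg_le :: "nat \<Rightarrow> 'a::zero poly \<Rightarrow> int \<Rightarrow> bool" where
  "wdeg_le m p N \<longleftrightarrow> (p \<noteq> 0 \<longrightarrow> int m * int (degree p) \<le> N)"

lemma wdeg_le_mono: "wdeg_le m p N \<Longrightarrow> N \<le> N' \<Longrightarrow> wdeg_le m p N'"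
  by (auto simp: wdeg_le_def)

lemma wdeg_le_add:
  assumes "wdeg_le m p N" "wdeg_le m q N"
  shows "wdeg_le m (p + q) N"
proof (cases "p = 0 \<or> q = 0")
  case False
  have "degree (p + q) \<le> degree p \<or> degree (p + q) \<le> degree q"
    using degree_add_le_max[of p q] by (auto simp: max_def split: if_splits)
  then have "int m * int (degree (p + q)) \<le> int m * int (degree p)
      \<or> int m * int (degree (p + q)) \<le> int m * int (degree q)"
    by (meson mult_left_mono of_nat_0_le_iff of_nat_mono)
  with False assms show ?thesis by (auto simp: wdeg_le_def)
qed (use assms in auto)

lemma wdeg_le_mult:
  fixes p q :: "'a::idom poly"
  assumes "wdeg_le m p M" "wdeg_le m q N"
  shows "wdeg_le m (p * q) (M + N)"
  using assms by (auto simp: wdeg_le_def degree_mult_eq distrib_left)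

lemma wdeg_le_pderiv:
  fixes p :: "'a::{idom,semiring_char_0} poly"
  assumes "wdeg_le m p N"
  shows "wdeg_le m (pderiv p) (N - int m)"
proof (cases "degree p")
  case 0
  then show ?thesis by (simp add: wdeg_le_def pderiv_eq_0_iff)
next
  case (Suc n)
  then have "p \<noteq> 0" by auto
  with assms Suc show ?thesis by (auto simp: wdeg_le_def degree_pderiv algebra_simps)
qed

text \<open>Between integers the \<open>- 1\<close> is a strict inequality, so the leading term of
  \<open>p\<close> meets nothing in \<open>q\<close> that could cancel it.\<close>

lemma degree_add_wdeg_less:
  fixes p q :: "'a::comm_ring poly"
  assumes "p \<noteq> 0" "wdeg_le m q (int m * int (degree p) - 1)"
  shows "p + q \<noteq> 0" "degree (p + q) = degree p"
proof -
  have "q \<noteq> 0 \<Longrightarrow> int m * int (degree q) < int m * int (degree p)"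
    using assms(2) by (auto simp: wdeg_le_def)
  then have "q \<noteq> 0 \<Longrightarrow> degree q < degree p"
    by (simp add: mult_less_cancel_left)
  then have less: "q = 0 \<or> degree q < degree p" by blast
  then show "degree (p + q) = degree p" using degree_add_eq_left by auto
  show "p + q \<noteq> 0"
  proof
    assume "p + q = 0"
    then have "q = - p" by (simp add: add_eq_0_iff)
    with less assms(1) show False by simp
  qed
qed

section \<open>The unique component of maximal weight and its motion\<close>

text \<open>The component \<open>b j\<close> multiplies \<open>D\<^bsup>m-j\<^esup>F\<close>; \<open>W\<close> is the weight of the form minus \<open>e m\<close>.\<close>

definition dominant :: "nat \<Rightarrow> int \<Rightarrow> int \<Rightarrow> (nat \<Rightarrow> 'a::zero poly) \<Rightarrow> nat \<Rightarrow> bool" where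
  "dominant m e W b j \<longleftrightarrow> j \<in> {1..m} \<and> b j \<noteq> 0 \<and> int m * int (degree (b j)) = W + e * int j \<and>
     (\<forall>i\<in>{1..m}. i \<noteq> j \<longrightarrow> wdeg_le m (b i) (W + e * int i - 1))"

text \<open>Up to a constant, the weight of component \<open>j\<close> is congruent to
  \<open>- e * j\<close> modulo \<open>m\<close>. The indices 1 to \<open>m\<close> are distinct
  residues, so the maximal weight is attained only once.\<close>

lemma dominant_exists:
  assumes e: "e = 1 \<or> e = -1" and nz: "\<exists>j\<in>{1..m}. b j \<noteq> 0"
  shows "\<exists>W j. dominant m e W b j"
proof -
  define w where "w j = int m * int (degree (b j)) - e * int j" for j
  define J where "J = {j\<in>{1..m}. b j \<noteq> 0}"
  have "finite J" "J \<noteq> {}" using nz by (auto simp: J_def)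
  then have "Max (w ` J) \<in> w ` J" and le: "\<And>i. i \<in> J \<Longrightarrow> w i \<le> Max (w ` J)"
    by auto
  then obtain j where j: "j \<in> J" "Max (w ` J) = w j" by blast
  have "w i < w j" if i: "i \<in> J" "i \<noteq> j" for i
  proof -
    have "w i \<noteq> w j"
    proof
      assume "w i = w j"
      then have "e * (int i - int j) = int m * (int (degree (b i)) - int (degree (b j)))"
        by (simp add: w_def algebra_simps)
      then have "int m dvd int i - int j"
        using e by (metis dvd_triv_left dvd_minus_iff mult_1 mult_minus1)
      moreover have "\<bar>int i - int j\<bar> < int m" using i j by (auto simp: J_def)
      ultimately show False using i(2) dvd_imp_le_int[of "int i - int j" "int m"] by auto
    qed
    with le[OF i(1)] j show ?thesis by simp
  qed
  then have "dominant m e (w j) b j"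
    using j(1) by (fastforce simp: dominant_def wdeg_le_def J_def w_def)
  then show ?thesis by blast
qed

text \<open>The top term is \<open>T * b j\<close>, landing at index \<open>j - 1\<close>, or
  \<open>Q m * b 1\<close>, landing at \<open>m\<close>, when \<open>j = 1\<close>. All other terms
  stay at least 1 below the new maximum.\<close>

lemma dominant_step:
  fixes T :: "'a::{idom,semiring_char_0} poly"
  assumes m: "m \<ge> 2" and e: "e = 1 \<or> e = -1" and T: "T \<noteq> 0"
    and Qm: "Q m \<noteq> 0" "int (degree (Q m)) = int (degree T) + e"
    and Q: "\<And>i. i \<in> {1..m-1} \<Longrightarrow> wdeg_le m (Q i) (int m * int (degree T) + e * int i - 1)"
    and dom: "dominant m e W b j"
    and rec: "\<And>i. i \<in> {1..m-1} \<Longrightarrow> b' i = Q i * b 1 + T * pderiv (b i) + T * b (i + 1)"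
    and rec_m: "b' m = Q m * b 1 + T * pderiv (b m)"
  shows "dominant m e (W + int m * int (degree T) + e) b' (if j = 1 then m else j - 1)"
proof -
  define S where "S = int m * int (degree T)"
  have j: "j \<in> {1..m}" and bj: "b j \<noteq> 0" and bjd: "int m * int (degree (b j)) = W + e * int j"
    and lt: "\<And>i. i \<in> {1..m} \<Longrightarrow> i \<noteq> j \<Longrightarrow> wdeg_le m (b i) (W + e * int i - 1)"
    using dom by (auto simp: dominant_def)
  have le: "wdeg_le m (b i) (W + e * int i)" if "i \<in> {1..m}" for i
    using lt[OF that] bjd by (cases "i = j") (auto simp: wdeg_le_def)
  have TS: "wdeg_le m T S" by (simp add: wdeg_le_def S_def)
  have Qi: "wdeg_le m (Q i) (S + e * int i - 1)" if "i \<in> {1..m-1}" for i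
    using Q[OF that] by (simp add: S_def)
  have QmS: "int m * int (degree (Q m)) = S + e * int m"
    by (simp add: Qm(2) S_def algebra_simps)
  have b1: "wdeg_le m (b 1) (W + e)" using le[of 1] m by simp
  \<comment> \<open>Differentiation lowers the weight by \<open>m\<close>, so
    \<open>- m \<le> e - 1\<close> is required; for \<open>e = -1\<close> this is exactly
    \<open>m \<ge> 2\<close>.\<close>
  have Td: "wdeg_le m (T * pderiv (b i)) (W + S + e + e * int i - 1)" if "i \<in> {1..m}" for i
    by (rule wdeg_le_mono[OF wdeg_le_mult[OF TS wdeg_le_pderiv[OF le[OF that]]]]) (use e m in auto)
  have Qb: "wdeg_le m (Q i * b 1) (W + S + e + e * int i - 1)" if "i \<in> {1..m-1}" for i
    by (rule wdeg_le_mono[OF wdeg_le_mult[OF Qi[OF that] b1]]) simp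
  have Tb: "wdeg_le m (T * b (i + 1)) (W + S + e + e * int i - 1)"
    if "i \<in> {1..m-1}" "i + 1 \<noteq> j" for i
    by (rule wdeg_le_mono[OF wdeg_le_mult[OF TS lt[of "i + 1"]]])
      (use that in \<open>auto simp: algebra_simps\<close>)
  have Qmb: "wdeg_le m (Q m * b 1) (W + S + e + e * int m - 1)" if "j \<noteq> 1"
  proof -
    have "wdeg_le m (Q m) (S + e * int m)" by (simp add: wdeg_le_def QmS)
    moreover have "wdeg_le m (b 1) (W + e * int 1 - 1)" by (rule lt) (use m that in auto)
    ultimately show ?thesis by (rule wdeg_le_mono[OF wdeg_le_mult]) simp
  qed
  define j' where "j' = (if j = 1 then m else j - 1)"
  have j': "j' \<in> {1..m}" using j m by (auto simp: j'_def)
  have "b' i \<noteq> 0 \<and> int m * int (degree (b' i)) = W + S + e + e * int i" if "i = j'" for i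
  proof (cases "j = 1")
    case True
    then have i: "i = m" using that by (simp add: j'_def)
    have nz: "Q m * b 1 \<noteq> 0" using Qm(1) bj True by simp
    have d: "int m * int (degree (Q m * b 1)) = W + S + e + e * int m"
      using Qm(1) bj True QmS bjd by (simp add: degree_mult_eq distrib_left)
    from Td[of m] m have "wdeg_le m (T * pderiv (b m)) (int m * int (degree (Q m * b 1)) - 1)"
      unfolding d by simp
    from degree_add_wdeg_less[OF nz this] show ?thesis using d by (simp add: i rec_m)
  next
    case False
    then have i: "i \<in> {1..m-1}" "i + 1 = j" using that j by (auto simp: j'_def)
    have nz: "T * b j \<noteq> 0" using T bj by simp
    have d: "int m * int (degree (T * b j)) = W + S + e + e * int i"
      using T bj bjd by (simp add: degree_mult_eq S_def flip: i(2)) (simp add: algebra_simps)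
    have "i \<in> {1..m}" using i by auto
    from wdeg_le_add[OF Qb[OF i(1)] Td[OF this]]
    have "wdeg_le m (Q i * b 1 + T * pderiv (b i)) (int m * int (degree (T * b j)) - 1)"
      by (simp add: d)
    from degree_add_wdeg_less[OF nz this] show ?thesis using d i by (simp add: rec add.commute)
  qed
  moreover have "wdeg_le m (b' i) (W + S + e + e * int i - 1)" if i: "i \<in> {1..m}" "i \<noteq> j'" for i
  proof (cases "i = m")
    case True
    then have "j \<noteq> 1" using i by (auto simp: j'_def)
    with True m show ?thesis unfolding True rec_m by (intro wdeg_le_add Qmb Td) auto
  next
    case False
    then have "i \<in> {1..m-1}" "i + 1 \<noteq> j" using i by (auto simp: j'_def split: if_splits)
    then show ?thesis using i by (simp only: rec) (intro wdeg_le_add Qb Td Tb)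
  qed
  ultimately have "dominant m e (W + S + e) b' j'"
    using j' unfolding dominant_def by blast
  then show ?thesis by (simp add: S_def j'_def)
qed

section \<open>A determinant with one dominant Leibniz term\<close>

text \<open>The column weights \<open>v\<close> add up to the same sum along every permutation.
  Row-wise dominance of the weighted entries thus makes the \<open>\<sigma>\<close> product strictly
  larger in plain degree than any other.\<close>

lemma det_nonzero_if_dominant_permutation:
  fixes A :: "'a::idom poly mat" and v :: "nat \<Rightarrow> int"
  assumes A: "A \<in> carrier_mat m m"
    and \<sigma>: "\<sigma> permutes {0..<m}"
    and nz: "\<And>i. i < m \<Longrightarrow> A $$ (i, \<sigma> i) \<noteq> 0"
    and less: "\<And>i j. i < m \<Longrightarrow> j < m \<Longrightarrow> j \<noteq> \<sigma> i \<Longrightarrow> A $$ (i, j) \<noteq> 0 \<Longrightarrow>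
      c * int (degree (A $$ (i, j))) + v j < c * int (degree (A $$ (i, \<sigma> i))) + v (\<sigma> i)"
    and c: "c > 0"
  shows "det A \<noteq> 0"
proof -
  define P where "P \<pi> = (\<Prod>i = 0..<m. A $$ (i, \<pi> i))" for \<pi>
  have P\<sigma>: "P \<sigma> \<noteq> 0" using nz by (simp add: P_def)
  have deg_less: "P \<pi> = 0 \<or> degree (P \<pi>) < degree (P \<sigma>)"
    if \<pi>: "\<pi> permutes {0..<m}" "\<pi> \<noteq> \<sigma>" for \<pi>
  proof (cases "P \<pi> = 0")
    case False
    then have nz\<pi>: "A $$ (i, \<pi> i) \<noteq> 0" if "i < m" for i using that by (auto simp: P_def)
    have deg: "degree (P \<tau>) = (\<Sum>i = 0..<m. degree (A $$ (i, \<tau> i)))"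
      if "\<And>i. i < m \<Longrightarrow> A $$ (i, \<tau> i) \<noteq> 0" for \<tau>
      unfolding P_def using that by (intro degree_prod_eq_sum_degree) auto
    have v: "(\<Sum>i = 0..<m. v (\<tau> i)) = (\<Sum>i = 0..<m. v i)" if "\<tau> permutes {0..<m}" for \<tau>
      using sum.permute[OF that, of v] by (simp add: comp_def)
    have in_range: "\<pi> i < m" if "i < m" for i
      using permutes_in_image[OF \<pi>(1), of i] that by simp
    obtain i where i: "i < m" "\<pi> i \<noteq> \<sigma> i"
    proof -
      obtain i where "\<pi> i \<noteq> \<sigma> i" using \<pi>(2) by blast
      \<comment> \<open>Both permutations are the identity outside \<open>{0..<m}\<close>, so they
        can only differ at a row index.\<close>
      moreover from this have "i \<in> {0..<m}"
        using permutes_not_in[OF \<pi>(1), of i] permutes_not_in[OF \<sigma>, of i] by metis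
      ultimately show thesis using that by simp
    qed
    have "(\<Sum>i = 0..<m. c * int (degree (A $$ (i, \<pi> i))) + v (\<pi> i))
        < (\<Sum>i = 0..<m. c * int (degree (A $$ (i, \<sigma> i))) + v (\<sigma> i))"
    proof (rule sum_strict_mono_ex1)
      show "\<forall>i\<in>{0..<m}. c * int (degree (A $$ (i, \<pi> i))) + v (\<pi> i)
          \<le> c * int (degree (A $$ (i, \<sigma> i))) + v (\<sigma> i)"
      proof
        fix i assume "i \<in> {0..<m}"
        then show "c * int (degree (A $$ (i, \<pi> i))) + v (\<pi> i)
          \<le> c * int (degree (A $$ (i, \<sigma> i))) + v (\<sigma> i)"
          using less[of i "\<pi> i"] in_range nz\<pi> by (cases "\<pi> i = \<sigma> i") force+
      qed
      show "\<exists>i\<in>{0..<m}. c * int (degree (A $$ (i, \<pi> i))) + v (\<pi> i)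
          < c * int (degree (A $$ (i, \<sigma> i))) + v (\<sigma> i)"
        using less[of i "\<pi> i"] in_range nz\<pi> i by auto
    qed simp
    then have "c * int (degree (P \<pi>)) < c * int (degree (P \<sigma>))"
      using v[OF \<pi>(1)] v[OF \<sigma>]
      by (simp add: sum.distrib deg nz nz\<pi> flip: sum_distrib_left)
    then show ?thesis using c by simp
  qed simp
  \<comment> \<open>At this degree only the \<open>\<sigma>\<close> term contributes, namely its
    leading coefficient up to sign.\<close>
  have "coeff (det A) (degree (P \<sigma>))
      = (\<Sum>\<pi> | \<pi> permutes {0..<m}. coeff (signof \<pi> * P \<pi>) (degree (P \<sigma>)))"
    by (simp add: det_def'[OF A] P_def coeff_sum)
  also have "\<dots> = (\<Sum>\<pi> | \<pi> permutes {0..<m}.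
      if \<pi> = \<sigma> then coeff (signof \<sigma> * P \<sigma>) (degree (P \<sigma>)) else 0)"
  proof (rule sum.cong)
    fix \<pi> assume "\<pi> \<in> {\<pi>. \<pi> permutes {0..<m}}"
    then have "\<pi> \<noteq> \<sigma> \<Longrightarrow> coeff (P \<pi>) (degree (P \<sigma>)) = 0"
      using deg_less[of \<pi>] by (auto intro: coeff_eq_0)
    then show "coeff (signof \<pi> * P \<pi>) (degree (P \<sigma>))
        = (if \<pi> = \<sigma> then coeff (signof \<sigma> * P \<sigma>) (degree (P \<sigma>)) else 0)"
      by (auto simp: sign_def)
  qed simp
  also have "\<dots> = coeff (signof \<sigma> * P \<sigma>) (degree (P \<sigma>))"
    using \<sigma> by (simp add: finite_permutations sum.delta)
  also have "\<dots> \<noteq> 0" using P\<sigma> by (auto simp: sign_def)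
  finally show ?thesis by auto
qed

section \<open>Cyclic dominant positions and the determinants\<close>

theorem theorem3p2:
  fixes m :: nat
    and T :: "'a::field_char_0 poly"
    and Q :: "nat \<Rightarrow> 'a poly"
    and B :: "nat \<Rightarrow> nat \<Rightarrow> 'a poly"
  assumes m: "m \<ge> 2"
    and deg:
      "(edegree T \<ge> 0 \<and> edegree (Q m) = edegree T + 1 \<and>
          (\<forall>j\<in>{1..m-1}. edegree (Q j) < edegree (Q m))) \<or>
       (edegree (Q m) \<ge> 0 \<and> edegree T = edegree (Q m) + 1 \<and>
          (\<forall>j\<in>{1..m}. edegree (Q j) \<le> edegree (Q m)))"
    and B0: "\<exists>j\<in>{1..m}. B 0 j \<noteq> 0"
    and B_Suc: "\<And>k j. j \<in> {1..m-1} \<Longrightarrow>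
          B (k + 1) j = Q j * B k 1 + T * pderiv (B k j) + T * B k (j + 1)"
    and B_Suc_m: "\<And>k. B (k + 1) m = Q m * B k 1 + T * pderiv (B k m)"
  shows "\<forall>k. det (B_mat m B k) \<noteq> 0"
proof
  fix k
  obtain e :: int where e: "e = 1 \<or> e = -1" and T: "T \<noteq> 0"
    and Qm: "Q m \<noteq> 0" "int (degree (Q m)) = int (degree T) + e"
    and Q: "\<And>i. i \<in> {1..m-1} \<Longrightarrow> wdeg_le m (Q i) (int m * int (degree T) + e * int i - 1)"
    using deg
  proof
    assume h: "edegree T \<ge> 0 \<and> edegree (Q m) = edegree T + 1 \<and>
        (\<forall>j\<in>{1..m-1}. edegree (Q j) < edegree (Q m))"
    then have T: "T \<noteq> 0" by (auto simp: edegree_def)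
    then have Qm: "Q m \<noteq> 0" "degree (Q m) = degree T + 1"
      using h by (auto simp: edegree_def one_ereal_def split: if_splits)
    have "wdeg_le m (Q i) (int m * int (degree T) + 1 * int i - 1)" if i: "i \<in> {1..m-1}" for i
    proof -
      have "edegree (Q i) < edegree (Q m)" using h i by blast
      then have "Q i \<noteq> 0 \<Longrightarrow> degree (Q i) \<le> degree T"
        using Qm by (simp add: edegree_def)
      then have "Q i \<noteq> 0 \<Longrightarrow> int m * int (degree (Q i)) \<le> int m * int (degree T)"
        by (simp add: mult_left_mono)
      \<comment> \<open>With \<open>e = 1\<close> the bound leaves \<open>int i - 1\<close> to
        spare, nonnegative since \<open>i \<ge> 1\<close>.\<close>
      then show ?thesis using i by (auto simp: wdeg_le_def)
    qed
    with T Qm show thesis by (intro that[of 1]) auto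
  next
    assume h: "edegree (Q m) \<ge> 0 \<and> edegree T = edegree (Q m) + 1 \<and>
        (\<forall>j\<in>{1..m}. edegree (Q j) \<le> edegree (Q m))"
    then have Qm: "Q m \<noteq> 0" by (auto simp: edegree_def)
    then have T: "T \<noteq> 0" "degree T = degree (Q m) + 1"
      using h by (auto simp: edegree_def one_ereal_def split: if_splits)
    have "wdeg_le m (Q i) (int m * int (degree T) + (-1) * int i - 1)" if i: "i \<in> {1..m-1}" for i
    proof -
      have "i \<in> {1..m}" using i by auto
      then have "edegree (Q i) \<le> edegree (Q m)" using h by blast
      then have "Q i \<noteq> 0 \<Longrightarrow> degree (Q i) \<le> degree (Q m)"
        using Qm by (simp add: edegree_def)
      then have "Q i \<noteq> 0 \<Longrightarrow> int m * int (degree (Q i)) \<le> int m * int (degree (Q m))"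
        by (simp add: mult_left_mono)
      \<comment> \<open>With \<open>e = -1\<close> the degree of \<open>Q i\<close> is at least 1
        below that of \<open>T\<close>; the gained \<open>m\<close> covers \<open>i + 1\<close>
        because \<open>i \<le> m - 1\<close>.\<close>
      then show ?thesis using i by (auto simp: wdeg_le_def T(2) distrib_left)
    qed
    with T Qm show thesis by (intro that[of "-1"]) auto
  qed
  obtain W0 j0 where dom0: "dominant m e W0 (B 0) j0"
    using dominant_exists[OF e B0] by blast
  define J where "J n = ((\<lambda>j. if j = 1 then m else j - 1) ^^ n) j0" for n
  have dom: "\<exists>W. dominant m e W (B n) (J n)" for n
  proof (induction n)
    case 0
    then show ?case using dom0 by (auto simp: J_def)
  next
    case (Suc n)
    then obtain W where "dominant m e W (B n) (J n)" by blast
    from dominant_step[OF m e T Qm Q this B_Suc B_Suc_m] show ?case by (auto simp: J_def)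
  qed
  have J_range: "J n \<in> {1..m}" for n using dom[of n] by (auto simp: dominant_def)
  \<comment> \<open>Each step lowers the position by 1 modulo \<open>m\<close>; this invariant
    separates the positions of any \<open>m\<close> consecutive forms.\<close>
  have J_mod: "(int (J n) + int n) mod int m = int j0 mod int m" for n
  proof (induction n)
    case (Suc n)
    have "int (J (Suc n)) + int (Suc n) = int (J n) + int n + int m * (if J n = 1 then 1 else 0)"
      using J_range[of n] by (auto simp: J_def)
    then show ?case by (simp only: mod_mult_self2 Suc)
  qed (simp add: J_def)
  \<comment> \<open>Columns count from 0, hence the \<open>- 1\<close>; the identity outside the
    range is demanded by \<open>permutes\<close>.\<close>
  define \<sigma> where "\<sigma> i = (if i < m then J (k + i) - 1 else i)" for i
  have \<sigma>_J: "\<sigma> i < m" "\<sigma> i + 1 = J (k + i)" if "i < m" for i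
    using that J_range[of "k + i"] by (auto simp: \<sigma>_def)
  have "inj_on \<sigma> {0..<m}"
  proof (rule inj_onI)
    fix x y assume xy: "x \<in> {0..<m}" "y \<in> {0..<m}" "\<sigma> x = \<sigma> y"
    then have "J (k + x) = J (k + y)"
      using J_range[of "k + x"] J_range[of "k + y"] by (auto simp: \<sigma>_def)
    then have "(int (J (k + x)) + int (k + x)) mod int m = (int (J (k + x)) + int (k + y)) mod int m"
      using J_mod[of "k + x"] J_mod[of "k + y"] by simp
    then have "int m dvd int x - int y" by (simp add: mod_eq_dvd_iff)
    moreover have "\<bar>int x - int y\<bar> < int m" using xy by auto
    ultimately show "x = y" using dvd_imp_le_int[of "int x - int y" "int m"] by auto
  qed
  moreover have "\<sigma> ` {0..<m} \<subseteq> {0..<m}"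
    using \<sigma>_J(1) by auto
  ultimately have "bij_betw \<sigma> {0..<m} {0..<m}"
    by (simp add: bij_betw_def endo_inj_surj)
  then have \<sigma>: "\<sigma> permutes {0..<m}" by (rule bij_imp_permutes) (simp add: \<sigma>_def)
  show "det (B_mat m B k) \<noteq> 0"
  \<comment> \<open>This \<open>v\<close> cancels the term \<open>e * int j\<close> in
    \<open>dominant\<close>: in each row the dominant entry then scores \<open>W\<close> and every
    other nonzero entry at most \<open>W - 1\<close>.\<close>
  proof (rule det_nonzero_if_dominant_permutation[OF _ \<sigma>,
        where c = "int m" and v = "\<lambda>j. - e * int (j + 1)"])
    show "B_mat m B k \<in> carrier_mat m m" by (simp add: B_mat_def)
    show "int m > 0" using m by simp
    fix i assume i: "i < m"
    obtain W where W: "dominant m e W (B (k + i)) (\<sigma> i + 1)"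
      using dom[of "k + i"] \<sigma>_J(2)[OF i] by auto
    show "B_mat m B k $$ (i, \<sigma> i) \<noteq> 0"
      using W i \<sigma>_J(1)[OF i] by (simp add: B_mat_def dominant_def)
    fix j assume j: "j < m" "j \<noteq> \<sigma> i" "B_mat m B k $$ (i, j) \<noteq> 0"
    have "j + 1 \<in> {1..m}" "j + 1 \<noteq> \<sigma> i + 1" using j by auto
    then have "wdeg_le m (B (k + i) (j + 1)) (W + e * int (j + 1) - 1)"
      using W unfolding dominant_def by blast
    moreover have "int m * int (degree (B (k + i) (\<sigma> i + 1))) = W + e * int (\<sigma> i + 1)"
      using W unfolding dominant_def by blast
    ultimately show "int m * int (degree (B_mat m B k $$ (i, j))) + - e * int (j + 1)
        < int m * int (degree (B_mat m B k $$ (i, \<sigma> i))) + - e * int (\<sigma> i + 1)"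
      using i j \<sigma>_J(1)[OF i] by (simp add: B_mat_def wdeg_le_def)
  qed
qed

end
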